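(* Let $\alpha\in(0,1/45)$ and let $(x_1(0),x_2(0))\in[1,\infty)^2$ be any initial state. Let $\mathbf{x}(t)=(x_1(t),x_2(t))$, $t\ge0$, be generated by $$x_1(t+1)=\max\Big[\tfrac23x_1(t)+\tfrac13x_2(t)-10\alpha x_1(t),\,1\Big],\qquad x_2(t+1)=\max\Big[\tfrac13x_1(t)+\tfrac23x_2(t)+6\alpha x_2(t),\,1\Big].$$ Then $\mathbf{x}(t)$ converges exponentially fast to the point $\big(1,\frac{1}{1-18\alpha}\big)$ as $t\to\infty$.
   Context: The recursion is the decentralized projected gradient algorithm with constant stepsize $\alpha$ on $\Omega=[1,\infty)$ for two agents with local costs $g_1(x)=5x^2$, $g_2(x)=-3x^2$ and mixing matrix $\tilde W=\begin{pmatrix}2/3&1/3\\1/3&2/3\end{pmatrix}$. The total cost $g=(g_1+g_2)/2$ has minimizer $x_*=1$ on $\Omega$. Exponentially fast convergence means that the error is bounded by $C r^t$ for some constants $C>0$ and $r\in(0,1)$. *)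

theory Defs
  imports "HOL-Analysis.Analysis"
begin

definition converges_exponentially :: "(nat \<Rightarrow> 'a::metric_space) \<Rightarrow> 'a \<Rightarrow> bool" where
  "converges_exponentially X L \<longleftrightarrow>
    (\<exists>C>0. \<exists>r\<in>{0<..<1::real}. \<forall>t. dist (X t) L \<le> C * r ^ t)"

end

theory Submission
  imports Defs
begin

text \<open>
  On \<open>[1, \<infinity>)\<^sup>2\<close> the second projection never acts, since its argument is at least
  \<open>1 + 6\<alpha>\<close>; so the second coordinate evolves linearly. The point
  \<open>(1, z)\<close> with \<open>z = 1 / (1 - 18\<alpha>)\<close> is fixed: the second equation
  is \<open>(1/3 - 6\<alpha>) z = 1/3\<close>, and the first holds because the argument of its maximum,
  \<open>2/3 - 10\<alpha> + z/3\<close>, is at most \<open>1\<close>. The latter says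
  \<open>z \<le> 1 + 30\<alpha>\<close>, which is where \<open>\<alpha> < 1/45\<close> enters (\<open>weight_interval\<close>).

  As \<open>max _ 1\<close> is nonexpansive, the componentwise absolute errors are bounded after one step
  by their image under the matrix with rows \<open>(2/3 - 10\<alpha>, 1/3)\<close> and
  \<open>(1/3, 2/3 + 6\<alpha>)\<close>. This matrix need not contract the maximum or the unweighted sum
  of the errors, because its second row and column sum to \<open>1 + 6\<alpha> > 1\<close>. It does contract the
  sum with weights \<open>1\<close> and \<open>w\<close> exactly when its transpose, applied to \<open>(1, w)\<close>, decreases both
  entries, that is, when \<open>z < w < 1 + 30\<alpha>\<close>. So the same strict inequality that makes the point
  fixed leaves room for a contracting weighted norm, and the convergence is exponential.
\<close>

lemma converges_exponentially_of_contraction: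
  fixes X :: "nat \<Rightarrow> 'a::metric_space" and D :: "nat \<Rightarrow> real"
  assumes r: "0 < r" "r < 1"
    and step: "\<And>t. D (Suc t) \<le> r * D t"
    and dist: "\<And>t. dist (X t) L \<le> D t"
  shows "converges_exponentially X L"
proof -
  have D_le: "D t \<le> D 0 * r ^ t" for t
  proof (induction t)
    case (Suc t)
    have "D (Suc t) \<le> r * (D 0 * r ^ t)"
      using step[of t] mult_left_mono[OF Suc, of r] r by linarith
    then show ?case by (simp add: mult_ac)
  qed simp
  have "0 \<le> D 0"
    using dist[of 0] zero_le_dist[of "X 0" L] by linarith
  \<comment> \<open>The constant must be positive even if the sequence starts at its limit.\<close>
  have "dist (X t) L \<le> (D 0 + 1) * r ^ t" for t
  proof -
    have "D 0 * r ^ t \<le> (D 0 + 1) * r ^ t"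
      using r by (intro mult_right_mono) auto
    then show ?thesis using D_le[of t] dist[of t] by linarith
  qed
  then show ?thesis
    unfolding converges_exponentially_def using r \<open>0 \<le> D 0\<close>
    by (intro exI[of _ "D 0 + 1"] conjI bexI[of _ r]) auto
qed

text \<open>
  After clearing the denominator, the inequality is \<open>540 \<alpha>\<^sup>2 < 12 \<alpha>\<close>, which for
  positive \<open>\<alpha>\<close> means exactly \<open>\<alpha> < 1/45\<close>.
\<close>

lemma weight_interval:
  fixes \<alpha> :: real
  assumes "0 < \<alpha>" "\<alpha> < 1/45"
  shows "1 / (1 - 18 * \<alpha>) < 1 + 30 * \<alpha>"
proof -
  have "0 < 12 * \<alpha> * (1 - 45 * \<alpha>)"
    using assms by simp
  then have "1 < (1 + 30 * \<alpha>) * (1 - 18 * \<alpha>)"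
    by (simp add: algebra_simps)
  then show ?thesis
    using assms by (simp add: divide_less_eq)
qed

theorem theorem4p2:
  fixes \<alpha> :: real and x :: "nat \<Rightarrow> real ^ 2"
  assumes "\<alpha> \<in> {0<..<1/45}"
    and "x 0 $ 1 \<in> {1..}" and "x 0 $ 2 \<in> {1..}"
    and "\<And>t. x (Suc t) $ 1 = max (2/3 * x t $ 1 + 1/3 * x t $ 2 - 10 * \<alpha> * x t $ 1) 1"
    and "\<And>t. x (Suc t) $ 2 = max (1/3 * x t $ 1 + 2/3 * x t $ 2 + 6 * \<alpha> * x t $ 2) 1"
  shows "converges_exponentially x (vector [1, 1 / (1 - 18 * \<alpha>)])"
proof -
  have \<alpha>: "0 < \<alpha>" "\<alpha> < 1/45" using assms(1) by auto
  define z where "z = 1 / (1 - 18 * \<alpha>)"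
  define p where "p = 2/3 - 10 * \<alpha>"
  define q where "q = 2/3 + 6 * \<alpha>"
  have pq: "0 < p" "0 < q" using \<alpha> by (auto simp: p_def q_def)
  have z_fixed: "z = 1/3 + q * z"
    using \<alpha> by (simp add: z_def q_def field_simps)
  have z_less: "z < 1 + 30 * \<alpha>"
    unfolding z_def using weight_interval \<alpha> by blast
  have z_ge: "1 \<le> z"
    using \<alpha> by (simp add: z_def field_simps)
  obtain w where w: "z < w" "w < 1 + 30 * \<alpha>"
    using dense[OF z_less] by blast
  define r where "r = max (p + w/3) (1/(3*w) + q)"

  have "w > 0" using w z_ge by linarith
  have "p + w/3 < 1" using w by (simp add: p_def)
  moreover have "1/(3*w) + q < 1"
  proof -
    have "(1 - 18 * \<alpha>) * w > 1"
      using w(1) \<alpha> by (simp add: z_def divide_less_eq mult.commute)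
    then have "1/3 < (1 - q) * w"
      by (simp add: q_def algebra_simps)
    then have "1/(3*w) < 1 - q"
      using \<open>w > 0\<close> by (simp add: divide_less_eq mult_ac)
    then show ?thesis by simp
  qed
  moreover have "0 < p + w/3" using pq \<open>w > 0\<close> by simp
  ultimately have r: "0 < r" "r < 1" by (auto simp: r_def)

  have dom: "1 \<le> x t $ 1 \<and> 1 \<le> x t $ 2" for t
    using assms(2-5) by (cases t) auto
  have x1: "x (Suc t) $ 1 = max (p * x t $ 1 + x t $ 2 / 3) 1" for t
    unfolding assms(4) p_def by (simp add: algebra_simps)
  have x2: "x (Suc t) $ 2 = x t $ 1 / 3 + q * x t $ 2" for t
  proof -
    have "0 \<le> \<alpha> * x t $ 2" using dom[of t] \<alpha> by simp
    then show ?thesis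
      unfolding assms(5) q_def using dom[of t] by (simp add: algebra_simps)
  qed

  define e1 where "e1 t = \<bar>x t $ 1 - 1\<bar>" for t
  define e2 where "e2 t = \<bar>x t $ 2 - z\<bar>" for t
  define D where "D t = e1 t + w * e2 t" for t
  have e1_step: "e1 (Suc t) \<le> p * e1 t + e2 t / 3" for t
  proof -
    have "p + z/3 \<le> 1" using z_less by (simp add: p_def)
    then have "e1 (Suc t) \<le> \<bar>(p * x t $ 1 + x t $ 2 / 3) - (p + z/3)\<bar>"
      unfolding e1_def x1 by (auto simp: max_def)
    also have "\<dots> = \<bar>p * (x t $ 1 - 1) + (x t $ 2 - z) / 3\<bar>"
      by (simp add: algebra_simps diff_divide_distrib)
    also have "\<dots> \<le> \<bar>p * (x t $ 1 - 1)\<bar> + \<bar>(x t $ 2 - z) / 3\<bar>"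
      by (rule abs_triangle_ineq)
    finally show ?thesis
      using pq by (simp add: e1_def e2_def abs_mult)
  qed
  have e2_step: "e2 (Suc t) \<le> e1 t / 3 + q * e2 t" for t
  proof -
    have "x (Suc t) $ 2 - z = (x t $ 1 - 1) / 3 + q * (x t $ 2 - z)"
      using z_fixed by (simp add: x2 algebra_simps diff_divide_distrib)
    then have "e2 (Suc t) \<le> \<bar>(x t $ 1 - 1) / 3\<bar> + \<bar>q * (x t $ 2 - z)\<bar>"
      unfolding e2_def using abs_triangle_ineq by metis
    then show ?thesis
      using pq by (simp add: e1_def e2_def abs_mult)
  qed
  have D_step: "D (Suc t) \<le> r * D t" for t
  proof -
    have "D (Suc t) \<le> (p * e1 t + e2 t / 3) + w * (e1 t / 3 + q * e2 t)"
      unfolding D_def using e1_step[of t] e2_step[of t] \<open>w > 0\<close>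
      by (intro add_mono mult_left_mono) auto
    also have "\<dots> = (p + w/3) * e1 t + (1/(3*w) + q) * (w * e2 t)"
      using \<open>w > 0\<close> by (simp add: field_simps)
    also have "\<dots> \<le> r * e1 t + r * (w * e2 t)"
      using \<open>w > 0\<close> by (intro add_mono mult_right_mono) (auto simp: r_def e1_def e2_def)
    finally show ?thesis by (simp add: D_def distrib_left)
  qed
  have dist_le: "dist (x t) (vector [1, z]) \<le> D t" for t
  proof -
    have "dist (x t) (vector [1, z]) \<le> e1 t + e2 t"
      using norm_le_l1_cart[of "x t - vector [1, z]"]
      by (simp add: dist_norm sum_2 e1_def e2_def)
    also have "e2 t \<le> w * e2 t"
      using w z_ge by (intro mult_right_mono[of 1 w, simplified]) (auto simp: e2_def)
    finally show ?thesis by (simp add: D_def)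
  qed
  show ?thesis
    using converges_exponentially_of_contraction[of r D, OF r D_step dist_le] by (simp add: z_def)
qed

end
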